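(* For all integers $n \geq 0$, $k \geq 1$, $a \geq 1$, and arbitrary real $q$, $l_1, \ldots, l_k$, $x$, $y$ (with $l_1, \ldots, l_k \neq 0$), writing $L=(l_1,\ldots,l_k)$, $$c^{(k)}_{n,a,q,L,y}(x) = (-1)^{a-1} \sum_{m=0}^n (-1)^n \genfrac{[}{]}{0pt}{}{n}{m}_{(y,q)}\mathbb{C}_{m+a-1}^{(k)}(x;L)$$ and $$\widehat{c}^{(k)}_{n,a,q,L,y}(x) = (-1)^{a-1} \sum_{m=0}^n (-1)^{n-m} \genfrac{[}{]}{0pt}{}{n}{m}_{(-y,q)}\mathbb{C}_{m+a-1}^{(k)}(x;L).$$
   Context: The multiparameter poly-Cauchy polynomials of the first and second kind are $$c^{(k)}_{n,a,q,L,y}(x) = \int_0^{l_1}\!\! \cdots \int_0^{l_k} (t_1 \cdots t_k -x)^{a-1}\prod_{j=0}^{n-1}(t_1 \cdots t_k -x -y -j q)\, dt_1 \cdots dt_k,$$ $$\widehat{c}^{(k)}_{n,a,q,L,y}(x) = (-1)^{a-1} \int_0^{l_1}\!\! \cdots \int_0^{l_k} (x - t_1 \cdots t_k)^{a-1}\prod_{j=0}^{n-1}(x +y - t_1 \cdots t_k -j q)\, dt_1 \cdots dt_k,$$ where $t_i$ is integrated from $0$ to $l_i$. The (bivariate) Stirling polynomials of the first kind are $$\genfrac{[}{]}{0pt}{}{n}{m}_{(y,q)} = \sum_{i=0}^{n-m} \binom{i+m}{m}\genfrac{[}{]}{0pt}{}{n}{i+m}y^i q^{n-m-i}, \quad 0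 \leq m \leq n,$$ where $\genfrac{[}{]}{0pt}{}{n}{m}$ are the unsigned Stirling numbers of the first kind. The augmented polynomials are $\mathbb{C}_0^{(k)}(x;L)=l_1\cdots l_k$ and $$\mathbb{C}_j^{(k)}(x;L) = \sum_{i=0}^{j} \frac{(-1)^i}{(i+1)^k} (l_1 \cdots l_k )^{i+1} \binom{j}{i} x^{j-i},\quad j\ge1.$$ Zeroth powers are equal to $1$. *)

theory Defs
  imports "HOL-Analysis.Interval_Integral" "HOL-Combinatorics.Stirling"
begin

text \<open>The superscript \<open>k\<close> is the length of the list \<open>L = [l\<^sub>1, \<dots>, l\<^sub>k]\<close>.
  The interval integral below is oriented, so entries of \<open>L\<close> may be negative;
  the outermost integral belongs to \<open>l\<^sub>1\<close>.\<close>

primrec iterated_integral :: "real list \<Rightarrow> (real list \<Rightarrow> real) \<Rightarrow> real" where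
  "iterated_integral [] f = f []"
| "iterated_integral (l # L) f =
     (LBINT t=ereal 0..ereal l. iterated_integral L (\<lambda>ts. f (t # ts)))"

definition poly_Cauchy1 ::
    "nat \<Rightarrow> nat \<Rightarrow> real \<Rightarrow> real list \<Rightarrow> real \<Rightarrow> real \<Rightarrow> real" where
  "poly_Cauchy1 n a q L y x =
     iterated_integral L (\<lambda>ts. (prod_list ts - x) ^ (a - 1) *
       (\<Prod>j<n. prod_list ts - x - y - real j * q))"

definition poly_Cauchy2 ::
    "nat \<Rightarrow> nat \<Rightarrow> real \<Rightarrow> real list \<Rightarrow> real \<Rightarrow> real \<Rightarrow> real" where
  "poly_Cauchy2 n a q L y x =
     (-1) ^ (a - 1) * iterated_integral L (\<lambda>ts. (x - prod_list ts) ^ (a - 1) *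
       (\<Prod>j<n. x + y - prod_list ts - real j * q))"

text \<open>The library constant \<^const>\<open>stirling\<close> denotes the unsigned Stirling numbers of the
  first kind. The definition below is meant for \<open>m \<le> n\<close>.\<close>

definition stirling_poly :: "nat \<Rightarrow> nat \<Rightarrow> real \<Rightarrow> real \<Rightarrow> real" where
  "stirling_poly n m y q =
     (\<Sum>i=0..n - m. real ((i + m) choose m) * real (stirling n (i + m)) * y ^ i * q ^ (n - m - i))"

definition augmented_poly :: "nat \<Rightarrow> real \<Rightarrow> real list \<Rightarrow> real" where
  "augmented_poly j x L =
     (if j = 0 then prod_list L
      else (\<Sum>i=0..j. (-1) ^ i / real (i + 1) ^ length L * prod_list L ^ (i + 1) *
              real (j choose i) * x ^ (j - i)))"

end

theory Submission imports Defs begin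

text \<open>Put \<open>u = x - t\<^sub>1 \<cdots> t\<^sub>k\<close>. Both integrands are, up to sign, \<open>u ^ (a - 1)\<close> times a rising
  factorial of step \<open>q\<close>, namely \<open>\<Prod>j<n. u + y + j q\<close> for the first kind and
  \<open>\<Prod>j<n. - u - y + j q\<close> for the second. Expanding these by Stirling numbers and then binomially
  in \<open>y\<close> gives the bivariate Stirling polynomials as the coefficients of the powers of \<open>u\<close> and
  \<open>- u\<close>; the augmented polynomial of index \<open>j\<close> is the iterated integral of \<open>u ^ j\<close>.\<close>

lemma interval_integral_power_sum:
  fixes c :: "'a \<Rightarrow> real" and e :: "'a \<Rightarrow> nat"
  shows "(LBINT t=ereal a..ereal b. (\<Sum>s\<in>A. c s * t ^ e s)) =
    (\<Sum>s\<in>A. c s * ((b ^ (e s + 1) - a ^ (e s + 1)) / real (e s + 1)))"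
proof -
  define F where "F = (\<lambda>t::real. \<Sum>s\<in>A. c s * (t ^ (e s + 1) / real (e s + 1)))"
  have "(F has_vector_derivative (\<Sum>s\<in>A. c s * t ^ e s)) (at t within T)" for t T
    unfolding F_def has_real_derivative_iff_has_vector_derivative[symmetric]
    by (rule DERIV_sum) (auto intro!: derivative_eq_intros simp del: of_nat_Suc power_Suc)
  \<comment> \<open>The integral is oriented and \<open>b\<close> may lie below \<open>a\<close>,
    hence \<open>min\<close> and \<open>max\<close>.\<close>
  moreover have "continuous_on {min a b..max a b} (\<lambda>t. \<Sum>s\<in>A. c s * t ^ e s)"
    by (intro continuous_intros)
  ultimately have "(LBINT t=ereal a..ereal b. (\<Sum>s\<in>A. c s * t ^ e s)) = F b - F a"
    by (intro interval_integral_FTC_finite) auto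
  then show ?thesis
    by (simp add: F_def sum_subtractf[symmetric] diff_divide_distrib right_diff_distrib)
qed

text \<open>A family of exponents \<open>e\<close>, rather than a polynomial, lets expanded double sums be integrated
  without collecting powers; the induction absorbs \<open>t ^ e s\<close> into the coefficients.\<close>

lemma iterated_integral_power_sum:
  "iterated_integral L (\<lambda>ts. \<Sum>s\<in>A. c s * prod_list ts ^ e s) =
    (\<Sum>s\<in>A. c s * (prod_list L ^ (e s + 1) / real (e s + 1) ^ length L))"
proof (induction L arbitrary: c)
  case Nil
  show ?case by simp
next
  case (Cons l L)
  define K where "K s = prod_list L ^ (e s + 1) / real (e s + 1) ^ length L" for s
  have "iterated_integral L (\<lambda>ts. \<Sum>s\<in>A. c s * prod_list (t # ts) ^ e s) =
      (\<Sum>s\<in>A. c s * K s * t ^ e s)" for t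
    using Cons.IH[of "\<lambda>s. c s * t ^ e s"]
    by (simp add: K_def power_mult_distrib mult_ac)
  then have "iterated_integral (l # L) (\<lambda>ts. \<Sum>s\<in>A. c s * prod_list ts ^ e s) =
      (\<Sum>s\<in>A. c s * K s * (l ^ (e s + 1) / real (e s + 1)))"
    using interval_integral_power_sum[where a = 0 and b = l and A = A and c = "\<lambda>s. c s * K s" and e = e]
    by simp
  then show ?case
    by (simp add: K_def power_mult_distrib mult_ac)
qed

text \<open>At \<open>j = 0\<close> the only summand is \<open>prod_list L\<close>, so one formula
  covers both cases of the definition.\<close>

lemma augmented_poly_eq_sum:
  "augmented_poly j x L =
    (\<Sum>i\<le>j. (-1) ^ i * real (j choose i) * x ^ (j - i) *
      (prod_list L ^ (i + 1) / real (i + 1) ^ length L))"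
  unfolding augmented_poly_def
  by (auto simp: atMost_atLeast0 mult_ac intro!: sum.cong)

lemma iterated_integral_diff_power_sum:
  assumes "finite A"
  shows "iterated_integral L (\<lambda>ts. \<Sum>m\<in>A. d m * (x - prod_list ts) ^ e m) =
    (\<Sum>m\<in>A. d m * augmented_poly (e m) x L)"
proof -
  define c where "c = (\<lambda>(m, i). d m * ((-1) ^ i * real (e m choose i) * x ^ (e m - i)))"
  have expand: "(x - p) ^ j = (\<Sum>i\<le>j. (-1) ^ i * real (j choose i) * x ^ (j - i) * p ^ i)"
    for p :: real and j
    using binomial_ring[of "- p" x j] by (simp add: power_minus[of p] mult_ac)
  \<comment> \<open>Pairs \<open>(m, i)\<close> flatten the double sum; the exponent of
    \<open>p\<close> is then \<open>snd\<close>, the form that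
    \<open>iterated_integral_power_sum\<close> takes.\<close>
  have "(\<Sum>m\<in>A. d m * (x - p) ^ e m) = (\<Sum>s\<in>(SIGMA m:A. {..e m}). c s * p ^ snd s)" for p
    unfolding expand
    by (simp add: c_def sum.Sigma assms case_prod_unfold sum_distrib_left mult_ac)
  then have "iterated_integral L (\<lambda>ts. \<Sum>m\<in>A. d m * (x - prod_list ts) ^ e m) =
      (\<Sum>s\<in>(SIGMA m:A. {..e m}).
        c s * (prod_list L ^ (snd s + 1) / real (snd s + 1) ^ length L))"
    by (simp only: iterated_integral_power_sum)
  also have "\<dots> = (\<Sum>m\<in>A. d m * augmented_poly (e m) x L)"
    unfolding augmented_poly_eq_sum
    by (simp add: c_def sum.Sigma assms case_prod_unfold sum_distrib_left mult_ac)
  finally show ?thesis .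
qed

text \<open>Induction on \<open>n\<close>: the recurrence of the Stirling numbers mirrors
  multiplication by the new factor \<open>u + n q\<close>.\<close>

lemma prod_add_step_eq_stirling_sum:
  fixes u q :: "'a :: comm_ring_1"
  shows "(\<Prod>j<n. u + of_nat j * q) = (\<Sum>i\<le>n. of_nat (stirling n i) * u ^ i * q ^ (n - i))"
proof (induction n)
  case 0
  show ?case by simp
next
  case (Suc n)
  define F where "F = (\<Sum>i\<le>n. of_nat (stirling n i) * u ^ i * q ^ (n - i))"
  \<comment> \<open>For \<open>n > 0\<close> both \<open>stirling n (Suc n)\<close> and
    \<open>stirling n 0\<close> vanish, so shifting the index leaves just a factor \<open>q\<close>.
    For \<open>n = 0\<close> this fails, and the factor \<open>of_nat n\<close> makes both sides
    zero.\<close>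
  have shift: "of_nat n * (\<Sum>i\<le>n. of_nat (stirling n (Suc i)) * u ^ Suc i * q ^ (n - i)) =
      of_nat n * q * F"
  proof (cases n)
    case (Suc r)
    have "(\<Sum>i\<le>n. of_nat (stirling n (Suc i)) * u ^ Suc i * q ^ (n - i)) =
        (\<Sum>i\<le>r. of_nat (stirling n (Suc i)) * u ^ Suc i * (q * q ^ (r - i)))"
      unfolding Suc by (auto simp: Suc_diff_le intro!: sum.cong)
    also have "\<dots> = q * F"
      unfolding F_def Suc by (subst sum.atMost_Suc_shift) (simp add: sum_distrib_left mult_ac)
    finally show ?thesis by (simp add: mult_ac)
  qed simp
  have "(\<Sum>i\<le>Suc n. of_nat (stirling (Suc n) i) * u ^ i * q ^ (Suc n - i)) =
      (\<Sum>i\<le>n. of_nat (stirling (Suc n) (Suc i)) * u ^ Suc i * q ^ (n - i))"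
    by (subst sum.atMost_Suc_shift) simp
  also have "\<dots> = of_nat n * (\<Sum>i\<le>n. of_nat (stirling n (Suc i)) * u ^ Suc i * q ^ (n - i)) + u * F"
    by (simp add: F_def sum_distrib_left sum.distrib[symmetric] algebra_simps)
  also have "\<dots> = F * (u + of_nat n * q)"
    unfolding shift by (simp add: algebra_simps)
  finally show ?case
    using Suc by (simp add: F_def)
qed

text \<open>The binomial coefficient vanishes for \<open>i < m\<close>. The range no longer depends
  on \<open>m\<close>, which allows sums to be swapped later.\<close>

lemma stirling_poly_eq_sum:
  assumes "m \<le> n"
  shows "stirling_poly n m y q =
    (\<Sum>i\<le>n. real (i choose m) * real (stirling n i) * y ^ (i - m) * q ^ (n - i))"
proof -
  have "(\<Sum>i\<le>n. real (i choose m) * real (stirling n i) * y ^ (i - m) * q ^ (n - i)) =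
      (\<Sum>i=m..n. real (i choose m) * real (stirling n i) * y ^ (i - m) * q ^ (n - i))"
    by (rule sum.mono_neutral_right) auto
  also have "\<dots> = stirling_poly n m y q"
    unfolding stirling_poly_def
    using sum.shift_bounds_cl_nat_ivl[of
        "\<lambda>i. real (i choose m) * real (stirling n i) * y ^ (i - m) * q ^ (n - i)" 0 m "n - m"] assms
    by (simp add: add.commute)
  finally show ?thesis ..
qed

lemma prod_add_step_eq_stirling_poly_sum:
  "(\<Prod>j<n. u + y + real j * q) = (\<Sum>m=0..n. stirling_poly n m y q * u ^ m)"
proof -
  \<comment> \<open>Padding with zero terms up to \<open>n\<close> makes the range of
    \<open>m\<close> independent of \<open>i\<close>.\<close>
  have expand: "(u + y) ^ i = (\<Sum>m\<le>n. real (i choose m) * u ^ m * y ^ (i - m))" if "i \<le> n" for i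
    unfolding binomial_ring using that by (intro sum.mono_neutral_left) auto
  have "(\<Prod>j<n. u + y + real j * q) =
      (\<Sum>i\<le>n. \<Sum>m\<le>n. real (i choose m) * real (stirling n i) * y ^ (i - m) * q ^ (n - i) * u ^ m)"
    unfolding prod_add_step_eq_stirling_sum
    by (simp add: expand sum_distrib_left sum_distrib_right mult_ac)
  also have "\<dots> = (\<Sum>m\<le>n. stirling_poly n m y q * u ^ m)"
    by (subst sum.swap) (simp add: stirling_poly_eq_sum sum_distrib_right)
  finally show ?thesis by (simp add: atMost_atLeast0)
qed

lemma poly_Cauchy1_eq:
  assumes "a \<ge> 1"
  shows "poly_Cauchy1 n a q L y x =
    (-1) ^ (a - 1) *
      (\<Sum>m=0..n. (-1) ^ n * stirling_poly n m y q * augmented_poly (m + a - 1) x L)"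
proof -
  \<comment> \<open>This removes the truncated subtraction: \<open>m + a - 1\<close> becomes
    \<open>m + b\<close>.\<close>
  obtain b where a: "a = Suc b"
    using assms by (cases a) auto
  have "(p - x) ^ (a - 1) * (\<Prod>j<n. p - x - y - real j * q) =
      (\<Sum>m=0..n. (-1) ^ (a - 1) * ((-1) ^ n * stirling_poly n m y q) * (x - p) ^ (m + a - 1))" for p
  proof -
    have "(\<Prod>j<n. p - x - y - real j * q) = (\<Prod>j<n. - 1 * (x - p + y + real j * q))"
      by (simp add: algebra_simps)
    also have "\<dots> = (-1) ^ n * (\<Sum>m=0..n. stirling_poly n m y q * (x - p) ^ m)"
      unfolding prod.distrib prod_add_step_eq_stirling_poly_sum by simp
    moreover have "(p - x) ^ (a - 1) = (-1) ^ (a - 1) * (x - p) ^ (a - 1)"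
      by (simp flip: power_mult_distrib)
    ultimately show ?thesis
      by (simp add: a sum_distrib_left power_add mult_ac)
  qed
  then show ?thesis
    unfolding poly_Cauchy1_def
    by (simp only: iterated_integral_diff_power_sum finite_atLeastAtMost)
      (simp add: sum_distrib_left mult_ac)
qed

text \<open>The sign \<open>(-1) ^ (a - 1)\<close> is already in the definition here; for the first
  kind it comes from turning \<open>p - x\<close> into \<open>x - p\<close>.\<close>

lemma poly_Cauchy2_eq:
  assumes "a \<ge> 1"
  shows "poly_Cauchy2 n a q L y x =
    (-1) ^ (a - 1) *
      (\<Sum>m=0..n. (-1) ^ (n - m) * stirling_poly n m (- y) q * augmented_poly (m + a - 1) x L)"
proof -
  obtain b where a: "a = Suc b"
    using assms by (cases a) auto
  have "(x - p) ^ (a - 1) * (\<Prod>j<n. x + y - p - real j * q) =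
      (\<Sum>m=0..n. (-1) ^ (n - m) * stirling_poly n m (- y) q * (x - p) ^ (m + a - 1))" for p
  proof -
    \<comment> \<open>The product expands in powers of \<open>p - x\<close>; returning to
      \<open>x - p\<close> costs \<open>(-1) ^ m\<close>, which cancels against part of
      \<open>(-1) ^ n\<close>.\<close>
    have sign: "(-1) ^ n * (p - x) ^ m = (-1) ^ (n - m) * (x - p) ^ m" if "m \<le> n" for m
    proof -
      have "(-1) ^ n * (p - x) ^ m = (-1) ^ (n - m) * ((-1) ^ m * (p - x) ^ m)"
        using that by (simp flip: power_add mult.assoc)
      then show ?thesis
        by (simp flip: power_mult_distrib)
    qed
    \<comment> \<open>Negating each factor makes the step \<open>+ q\<close> and turns
      \<open>y\<close> into \<open>- y\<close>.\<close>
    have "(\<Prod>j<n. x + y - p - real j * q) = (\<Prod>j<n. - 1 * (p - x + - y + real j * q))"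
      by (simp add: algebra_simps)
    also have "\<dots> = (-1) ^ n * (\<Sum>m=0..n. stirling_poly n m (- y) q * (p - x) ^ m)"
      unfolding prod.distrib prod_add_step_eq_stirling_poly_sum by simp
    also have "\<dots> = (\<Sum>m=0..n. stirling_poly n m (- y) q * ((-1) ^ n * (p - x) ^ m))"
      by (simp add: sum_distrib_left mult_ac)
    also have "\<dots> = (\<Sum>m=0..n. (-1) ^ (n - m) * stirling_poly n m (- y) q * (x - p) ^ m)"
      by (intro sum.cong refl) (simp add: sign)
    finally show ?thesis
      by (simp add: a sum_distrib_left power_add mult_ac)
  qed
  then show ?thesis
    unfolding poly_Cauchy2_def by (simp only: iterated_integral_diff_power_sum finite_atLeastAtMost)
qed

theorem theorem12:
  fixes n k a :: nat and q x y :: real and L :: "real list"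
  assumes "k \<ge> 1" and "a \<ge> 1" and "length L = k" and "\<forall>l\<in>set L. l \<noteq> 0"
  shows "poly_Cauchy1 n a q L y x =
           (-1) ^ (a - 1) *
             (\<Sum>m=0..n. (-1) ^ n * stirling_poly n m y q * augmented_poly (m + a - 1) x L) \<and>
         poly_Cauchy2 n a q L y x =
           (-1) ^ (a - 1) *
             (\<Sum>m=0..n. (-1) ^ (n - m) * stirling_poly n m (- y) q * augmented_poly (m + a - 1) x L)"
  using assms(2) poly_Cauchy1_eq poly_Cauchy2_eq by blast

end
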